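(* Let $\mathcal{T}$ be a nontrivial repcon topology for Scott's graph model $\mathcal{P}(\mathbb{N})$. Then $\mathcal{T}$ contains either the Scott topology or the Alexandroff topology (the topology whose open sets are precisely the subsets of $\mathcal{P}(\mathbb{N})$ that are downward closed with respect to $\subseteq$).
   Context: Scott's graph model is the set $\mathcal{P}(\mathbb{N})$ of subsets of $\mathbb{N}$ with (total) application $A\circ B=\{n\mid \exists m\,([m,n]\in A,\ e_m\subseteq B)\}$, where $[\cdot,\cdot]$ is a standard bijective pairing on $\mathbb{N}$ and $e_k$ is the finite set $p$ with $k=\sum_{i\in p}2^i$. It is a partial combinatory algebra (pca). A partial function $f$ on a pca $\mathcal{A}$ is representable if there is $a_f\in\mathcal{A}$ with $a_fa=f(a)$ for all $a$ in the domain of $f$. A topology on a pca $\mathcal{A}$ is repcon if every partial representable function $\mathcal{A}\to\mathcal{A}$ is continuous on its domain (as subspace of $\mathcal{A}$). The trivial topologies are the discrete and the indiscrete one; nontrivial means neither of these. The Scott topology on $\mathcal{P}(\mathbb{N})$ has as basis the sets $U_p=\{A\subseteq\mathbb{N}\mid p\subseteq A\}$ for finite $p\subseteq\mathbb{N}$. *)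

theory Defs
  imports "HOL-Analysis.Abstract_Topology" "HOL-Library.Nat_Bijection"
begin

text \<open>
  An application is a binary operation on the carrier type, partial in general: the value
  \<open>None\<close> means that it is undefined. Partial functions are maps \<open>f :: 'a \<rightharpoonup> 'a\<close>
  with domain \<open>dom f\<close>.
\<close>

definition representable :: "('a \<Rightarrow> 'a \<rightharpoonup> 'a) \<Rightarrow> ('a \<rightharpoonup> 'a) \<Rightarrow> bool" where
  "representable app f \<longleftrightarrow> (\<exists>r. \<forall>a\<in>dom f. app r a = f a)"

definition repcon :: "('a \<Rightarrow> 'a \<rightharpoonup> 'a) \<Rightarrow> 'a topology \<Rightarrow> bool" where
  "repcon app T \<longleftrightarrow> topspace T = UNIV \<and>
     (\<forall>f. representable app f \<longrightarrow>
        continuous_map (subtopology T (dom f)) T (\<lambda>a. the (f a)))"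

text \<open>
  Here \<^term>\<open>set_decode m\<close> is the finite set whose characteristic function is the binary
  expansion of \<open>m\<close>, and \<^term>\<open>prod_encode\<close> is the Cantor pairing function.
\<close>

definition graph_app :: "nat set \<Rightarrow> nat set \<rightharpoonup> nat set" where
  "graph_app A B = Some {n. \<exists>m. prod_encode (m, n) \<in> A \<and> set_decode m \<subseteq> B}"

text \<open>The library's \<^term>\<open>trivial_topology\<close> is the empty space, not the indiscrete topology.\<close>

definition indiscrete_topology :: "'a set \<Rightarrow> 'a topology" where
  "indiscrete_topology X = topology (\<lambda>U. U = {} \<or> U = X)"

lemma openin_indiscrete_topology:
  "openin (indiscrete_topology X) U \<longleftrightarrow> U = {} \<or> U = X"
proof -
  have "istopology (\<lambda>U. U = {} \<or> U = X)"
  proof (unfold istopology_def, intro conjI allI impI)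
    fix K assume K: "\<forall>S\<in>K. S = {} \<or> S = X"
    show "\<Union>K = {} \<or> \<Union>K = X"
    proof (cases "X \<in> K")
      case True
      with K have "\<Union>K = X" by force
      then show ?thesis ..
    next
      case False
      with K have "\<Union>K = {}" by auto
      then show ?thesis ..
    qed
  qed auto
  then show ?thesis
    by (simp add: indiscrete_topology_def topology_inverse')
qed

definition scott_topology :: "nat set topology" where
  "scott_topology =
     topology (arbitrary union_of (\<lambda>U. \<exists>p. finite p \<and> U = {A. p \<subseteq> A}))"

lemma openin_scott_topology:
  "openin scott_topology = arbitrary union_of (\<lambda>U. \<exists>p. finite p \<and> U = {A. p \<subseteq> A})"
proof -
  have "istopology (arbitrary union_of (\<lambda>U. \<exists>p. finite p \<and> U = {A :: nat set. p \<subseteq> A}))"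
  proof (rule istopology_base)
    fix S T :: "nat set set"
    assume S: "\<exists>p. finite p \<and> S = {A. p \<subseteq> A}" and T: "\<exists>p. finite p \<and> T = {A. p \<subseteq> A}"
    from S obtain p where p: "finite p \<and> S = {A. p \<subseteq> A}" ..
    from T obtain q where q: "finite q \<and> T = {A. q \<subseteq> A}" ..
    have "finite (p \<union> q) \<and> S \<inter> T = {A. p \<union> q \<subseteq> A}"
      using p q by auto
    then show "\<exists>p. finite p \<and> S \<inter> T = {A. p \<subseteq> A}" ..
  qed
  then show ?thesis
    by (simp add: scott_topology_def topology_inverse')
qed

definition alexandroff_topology :: "nat set topology" where
  "alexandroff_topology = topology (\<lambda>U. \<forall>A\<in>U. \<forall>B. B \<subseteq> A \<longrightarrow> B \<in> U)"

lemma openin_alexandroff_topology: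
  "openin alexandroff_topology U \<longleftrightarrow> (\<forall>A\<in>U. \<forall>B. B \<subseteq> A \<longrightarrow> B \<in> U)"
proof -
  have "istopology (\<lambda>U. \<forall>A\<in>U. \<forall>B. B \<subseteq> A \<longrightarrow> B \<in> (U :: nat set set))"
  proof (unfold istopology_def, intro conjI allI impI ballI)
    fix K :: "nat set set set" and A B :: "nat set"
    assume K: "\<forall>S\<in>K. \<forall>A\<in>S. \<forall>B. B \<subseteq> A \<longrightarrow> B \<in> S"
      and A: "A \<in> \<Union>K" and B: "B \<subseteq> A"
    from A obtain S where "S \<in> K" "A \<in> S" ..
    with K B have "B \<in> S" by simp
    with \<open>S \<in> K\<close> show "B \<in> \<Union>K" ..
  qed auto
  then show ?thesis
    by (simp add: alexandroff_topology_def topology_inverse')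
qed

end

theory Submission
  imports Defs
begin

text \<open>
  For \<open>A \<subseteq> B\<close> and a Scott-open \<open>W\<close>, the two-valued map sending \<open>W\<close> to \<open>B\<close> and the rest to \<open>A\<close> is
  Scott continuous, hence representable. If some open set contains \<open>B\<close> but not \<open>A\<close>, pulling it back
  shows that every Scott-open \<open>W\<close> is open; if it contains \<open>A\<close> but not \<open>B\<close>, every Scott-closed set is
  open, in particular every principal downset, and these generate the Alexandroff topology.
  An open set other than \<open>\<emptyset>\<close> and the whole space always separates some comparable pair: if it
  contains \<open>A\<close> but not \<open>B\<close>, then it separates \<open>A \<union> B\<close> from \<open>A\<close> or from \<open>B\<close>.
\<close>

text \<open>Basic opens come from finite sets, and every finite \<open>p\<close> is
  \<open>set_decode (set_encode p)\<close>. This turns Scott openness into the test on coded finite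
  subsets that \<open>graph_app\<close> performs.\<close>

lemma scott_open_iff_set_decode:
  assumes "openin scott_topology W"
  shows "X \<in> W \<longleftrightarrow> (\<exists>m. set_decode m \<subseteq> X \<and> set_decode m \<in> W)"
proof -
  obtain K where K: "\<And>V. V \<in> K \<Longrightarrow> \<exists>p. finite p \<and> V = {A. p \<subseteq> A}" and W: "W = \<Union>K"
    using assms by (auto simp: openin_scott_topology union_of_def arbitrary_def)
  show ?thesis
  proof
    assume "X \<in> W"
    then obtain V where V: "V \<in> K" "X \<in> V" using W by blast
    then obtain p where p: "finite p" "V = {A. p \<subseteq> A}" using K[OF V(1)] by blast
    have "set_decode (set_encode p) \<subseteq> X \<and> set_decode (set_encode p) \<in> W"
      using V p W by auto
    then show "\<exists>m. set_decode m \<subseteq> X \<and> set_decode m \<in> W" ..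
  next
    assume "\<exists>m. set_decode m \<subseteq> X \<and> set_decode m \<in> W"
    then obtain m V where m: "set_decode m \<subseteq> X" and V: "V \<in> K" "set_decode m \<in> V"
      using W by blast
    then have "X \<in> V" using K[OF V(1)] by auto
    then show "X \<in> W" using V(1) W by blast
  qed
qed

lemma openin_scott_topologyI:
  assumes "\<And>X. X \<in> W \<Longrightarrow> \<exists>p. finite p \<and> p \<subseteq> X \<and> {A. p \<subseteq> A} \<subseteq> W"
  shows "openin scott_topology W"
proof (subst openin_subopen, intro ballI)
  fix X assume "X \<in> W"
  from assms[OF this] obtain p where p: "finite p" "p \<subseteq> X" "{A. p \<subseteq> A} \<subseteq> W"
    by (elim exE conjE)
  have "openin scott_topology {A. p \<subseteq> A}"
    unfolding openin_scott_topology using p(1) by (auto intro!: arbitrary_union_of_inc)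
  then have "openin scott_topology {A. p \<subseteq> A} \<and> X \<in> {A. p \<subseteq> A} \<and> {A. p \<subseteq> A} \<subseteq> W"
    using p(2,3) by simp
  then show "\<exists>V. openin scott_topology V \<and> X \<in> V \<and> V \<subseteq> W" ..
qed

lemma representable_two_valued:
  assumes "openin scott_topology W" and "A \<subseteq> B"
  shows "representable graph_app (\<lambda>X. Some (if X \<in> W then B else A))"
proof -
  \<comment> \<open>\<open>r\<close> lists the graph of the map: elements of \<open>A\<close> are
    output for every code \<open>m\<close>, elements of \<open>B\<close> only once the finite set
    coded by \<open>m\<close> certifies membership in \<open>W\<close>.\<close>
  define r where
    "r = prod_encode ` {(m, n). n \<in> A \<or> n \<in> B \<and> set_decode m \<in> W}"
  have r: "prod_encode (m, n) \<in> r \<longleftrightarrow> n \<in> A \<or> n \<in> B \<and> set_decode m \<in> W" for m n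
    unfolding r_def by (subst inj_image_mem_iff) (auto simp: inj_prod_encode)
  have "{n. \<exists>m. prod_encode (m, n) \<in> r \<and> set_decode m \<subseteq> X} = (if X \<in> W then B else A)" for X
  proof -
    \<comment> \<open>Code 0 is the empty set, so elements of \<open>A\<close> are output on every
      input \<open>X\<close>.\<close>
    have "set_decode 0 \<subseteq> X" by simp
    then have "(\<exists>m. prod_encode (m, n) \<in> r \<and> set_decode m \<subseteq> X) \<longleftrightarrow> n \<in> A \<or> n \<in> B \<and> X \<in> W" for n
      unfolding r scott_open_iff_set_decode[OF assms(1), of X] by blast
    \<comment> \<open>On \<open>W\<close> the output is \<open>A \<union> B\<close>, which is
      \<open>B\<close> because \<open>A \<subseteq> B\<close>.\<close>
    then show ?thesis using assms(2) by auto
  qed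
  then show ?thesis
    unfolding representable_def graph_app_def by blast
qed

lemma repcon_openin_two_valued_vimage:
  assumes "repcon graph_app T" and "openin T U" and "openin scott_topology W" and "A \<subseteq> B"
  shows "openin T {X. (if X \<in> W then B else A) \<in> U}"
proof -
  let ?f = "\<lambda>X. Some (if X \<in> W then B else A)"
  have "continuous_map (subtopology T (dom ?f)) T (\<lambda>X. the (?f X))"
    using assms(1) representable_two_valued[OF assms(3,4)] unfolding repcon_def by blast
  moreover have "dom ?f = UNIV" by auto
  ultimately have "continuous_map T T (\<lambda>X. if X \<in> W then B else A)" by simp
  from openin_continuous_map_preimage[OF this assms(2)] show ?thesis
    using assms(1) by (simp add: repcon_def)
qed

lemma repcon_contains_scott:
  assumes "repcon graph_app T" and "openin T U" and "A \<subseteq> B" and "A \<notin> U" and "B \<in> U"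
    and "openin scott_topology W"
  shows "openin T W"
proof -
  have "{X. (if X \<in> W then B else A) \<in> U} = W" using assms by auto
  then show ?thesis using repcon_openin_two_valued_vimage[OF assms(1,2,6,3)] by simp
qed

lemma repcon_contains_alexandroff:
  assumes "repcon graph_app T" and "openin T U" and "A \<subseteq> B" and "A \<in> U" and "B \<notin> U"
    and "openin alexandroff_topology V"
  shows "openin T V"
proof (subst openin_subopen, intro ballI)
  fix Y assume Y: "Y \<in> V"
  \<comment> \<open>The complement of the principal downset \<open>Pow Y\<close>: the map takes the
    value \<open>A\<close>, the one in \<open>U\<close>, exactly on \<open>Pow Y\<close>.\<close>
  let ?W = "{X. \<not> X \<subseteq> Y}"
  have W: "openin scott_topology ?W"
  proof (rule openin_scott_topologyI)
    fix X assume "X \<in> ?W"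
    then obtain n where "n \<in> X" "n \<notin> Y" by blast
    \<comment> \<open>A single element outside \<open>Y\<close> already prevents inclusion in
      \<open>Y\<close>, for every superset of \<open>{n}\<close>.\<close>
    then have "finite {n} \<and> {n} \<subseteq> X \<and> {A. {n} \<subseteq> A} \<subseteq> ?W" by auto
    then show "\<exists>p. finite p \<and> p \<subseteq> X \<and> {A. p \<subseteq> A} \<subseteq> ?W" ..
  qed
  have "{X. (if X \<in> ?W then B else A) \<in> U} = Pow Y" using assms(4,5) by auto
  with repcon_openin_two_valued_vimage[OF assms(1,2) W assms(3)] have "openin T (Pow Y)"
    by (simp only:)
  moreover have "Pow Y \<subseteq> V" using assms(6) Y by (auto simp: openin_alexandroff_topology)
  ultimately show "\<exists>S. openin T S \<and> Y \<in> S \<and> S \<subseteq> V" by blast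
qed

theorem lemma2p1:
  fixes T :: "nat set topology"
  assumes "repcon graph_app T"
    and "T \<noteq> discrete_topology UNIV"
    and "T \<noteq> indiscrete_topology UNIV"
  shows "(\<forall>U. openin scott_topology U \<longrightarrow> openin T U) \<or>
         (\<forall>U. openin alexandroff_topology U \<longrightarrow> openin T U)"
proof -
  have "openin T UNIV"
    using assms(1) openin_topspace[of T] by (simp add: repcon_def)
  have "\<exists>U. openin T U \<and> U \<noteq> {} \<and> U \<noteq> UNIV"
  proof (rule ccontr)
    assume "\<nexists>U. openin T U \<and> U \<noteq> {} \<and> U \<noteq> UNIV"
    with \<open>openin T UNIV\<close> have "openin T U \<longleftrightarrow> U = {} \<or> U = UNIV" for U
      by (metis openin_empty)
    then have "T = indiscrete_topology UNIV"
      by (simp add: topology_eq openin_indiscrete_topology)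
    with assms(3) show False by contradiction
  qed
  then obtain U where U: "openin T U" "U \<noteq> {}" "U \<noteq> UNIV" by blast
  from U(2,3) obtain A B where "A \<in> U" "B \<notin> U" by blast
  show ?thesis
  proof (cases "A \<union> B \<in> U")
    case True
    with repcon_contains_scott[OF assms(1) U(1) _ \<open>B \<notin> U\<close>, of "A \<union> B"]
    show ?thesis by blast
  next
    case False
    with repcon_contains_alexandroff[OF assms(1) U(1) _ \<open>A \<in> U\<close>, of "A \<union> B"]
    show ?thesis by blast
  qed
qed

end
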